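(* Let $x_1,\dots,x_n\in\mathbb{R}^{d+1}$ be points (each with $0$-th coordinate equal to $1$), let $\lambda\in\mathbb{R}^n_+$, let $p=\frac rs\ge1$ with $r,s$ positive integers, and let $B\subset\mathbb{R}^d$ be a polytope, symmetric with respect to the origin and with nonempty interior, with set of extreme points $\mathrm{Ext}(B)=\{b_1,\dots,b_G\}$. Then, for every sufficiently large constant $M>0$ (depending on the data), the problem $$\min_{\beta}\ \sum_{i=1}^n\lambda_i\,\varepsilon_{(i)}(\beta)^p,\qquad \varepsilon_{x_i}(\beta)=\min_{y\in\mathcal H(\beta)}\|(x_i)_{-0}-y\|_B ,$$ is equivalent to the following disjunctive programming problem in the variables $\beta\in\mathbb{R}^{d+1}$, $\varepsilon\in\mathbb{R}^n$, $z,\theta\in\mathbb{R}^n_+$, $w\in\{0,1\}^{n\times n}$: $$\begin{aligned} \rho^*(B):=\min\ & \sum_{j=1}^n\lambda_j\theta_j\\ \text{s.t. } & z_i\le\theta_j+M(1-w_{ij}), && i,j=1,\dots,n,\\ & z_i^s\ge\varepsilon_i^r, && i=1,\dots,n,\\ & \textstyle\sum_{i=1}^n w_{ij}=1\ (j=1,\dots,n),\quad \sum_{j=1}^n w_{ij}=1\ (i=1,\dots,n),\\ & \theta_j\ge\theta_{j-1}, && j=2,\dots,n,\\ & \varepsilon_i\ge\beta^tx_i,\quad \varepsilon_i\ge-\beta^tx_i, && i=1,\dots,n,\\ & \beta_{-0}^t b_g\le1, && g=1,\dots,G,\\ & \bigvee_{g=1}^G\ \big(\beta_{-0}^t b_g=1\big).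 \end{aligned}$$
   Context: Vectors in $\mathbb{R}^{d+1}$ are indexed $0,1,\dots,d$; for $y\in\mathbb{R}^{d+1}$, $y_{-0}=(y_1,\dots,y_d)$. The points $x\in\mathbb{R}^{d+1}$ have $0$-th coordinate $1$, the actual point in $\mathbb{R}^d$ being $x_{-0}$. For $\beta\in\mathbb{R}^{d+1}$ with $\beta_{-0}\ne0$, $\mathcal H(\beta)=\{y\in\mathbb{R}^d:\ (1,y^t)\beta=0\}$; the first problem is over all such $\beta$. $\|\cdot\|_B$ is the norm on $\mathbb{R}^d$ with unit ball $B$; $B^0=\{v\in\mathbb{R}^d:\ v^tb_g\le1,\ g=1,\dots,G\}$ is the polar of $B$ and $\|\cdot\|_{B^0}$ the norm with unit ball $B^0$. $\varepsilon_{(1)}(\beta)\le\dots\le\varepsilon_{(n)}(\beta)$ are the residuals $\varepsilon_{x_1}(\beta),\dots,\varepsilon_{x_n}(\beta)$ sorted in nondecreasing order. "Equivalent" means: both problems have the same optimal value, the $\beta$-component of any optimal solution of the disjunctive program is optimal for the first problem, and for every optimal $\beta$ of the first problem, $\beta/\|\beta_{-0}\|_{B^0}$ is the $\beta$-component of an optimal solution of the disjunctive program. *)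

theory Defs
  imports "HOL-Analysis.Analysis"
begin

text \<open>
  A vector of dimension d + 1 with coordinates indexed 0, ..., d is a pair in
  \<^typ>\<open>real \<times> (real ^ 'd)\<close>: the first component is the coordinate of index 0, the second one
  collects the coordinates 1, ..., d. The inner product of pairs is the Euclidean one.
  Families indexed by 1, ..., n are functions on \<^typ>\<open>nat\<close> of which only the values on
  \<open>{1..n}\<close> are ever used.
\<close>

definition hyperplane :: "real \<times> (real ^ 'd) \<Rightarrow> (real ^ 'd) set" where
  "hyperplane \<beta> = {y. inner (1, y) \<beta> = 0}"

text \<open>The norm with unit ball B (Minkowski functional).\<close>

definition ball_norm :: "(real ^ 'd) set \<Rightarrow> real ^ 'd \<Rightarrow> real" where
  "ball_norm B v = Inf {t. t \<ge> 0 \<and> v \<in> (\<lambda>u. t *\<^sub>R u) ` B}"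

definition extreme_points :: "(real ^ 'd) set \<Rightarrow> (real ^ 'd) set" where
  "extreme_points B = {b. b extreme_point_of B}"

definition polar :: "(real ^ 'd) set \<Rightarrow> (real ^ 'd) set" where
  "polar B = {v. \<forall>b\<in>extreme_points B. inner v b \<le> 1}"

text \<open>
  The infimum below is attained whenever the hyperplane is proper and B is a compact
  convex symmetric body, so it is then the minimum distance.
\<close>

definition residual :: "(real ^ 'd) set \<Rightarrow> real \<times> (real ^ 'd) \<Rightarrow> real \<times> (real ^ 'd) \<Rightarrow> real" where
  "residual B \<beta> x = Inf ((\<lambda>y. ball_norm B (snd x - y)) ` hyperplane \<beta>)"

text \<open>The i-th smallest residual, for i in 1, ..., n (HOL lists are indexed from 0).\<close>

definition sorted_residual ::
    "(real ^ 'd) set \<Rightarrow> nat \<Rightarrow> (nat \<Rightarrow> real \<times> (real ^ 'd)) \<Rightarrow> real \<times> (real ^ 'd) \<Rightarrow> nat \<Rightarrow> real" where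
  "sorted_residual B n x \<beta> i = sort (map (\<lambda>k. residual B \<beta> (x k)) [1..<Suc n]) ! (i - 1)"

definition hyp_feasible :: "real \<times> (real ^ 'd) \<Rightarrow> bool" where
  "hyp_feasible \<beta> \<longleftrightarrow> snd \<beta> \<noteq> 0"

definition hyp_objective ::
    "(real ^ 'd) set \<Rightarrow> nat \<Rightarrow> (nat \<Rightarrow> real \<times> (real ^ 'd)) \<Rightarrow> (nat \<Rightarrow> real) \<Rightarrow> real
      \<Rightarrow> real \<times> (real ^ 'd) \<Rightarrow> real" where
  "hyp_objective B n x lam p \<beta> = (\<Sum>i=1..n. lam i * sorted_residual B n x \<beta> i powr p)"

text \<open>The variables \<open>(\<beta>, \<epsilon>, z, \<theta>, w)\<close> of the disjunctive program.\<close>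

type_synonym 'd dp_vars =
  "(real \<times> (real ^ 'd)) \<times> (nat \<Rightarrow> real) \<times> (nat \<Rightarrow> real) \<times> (nat \<Rightarrow> real) \<times> (nat \<Rightarrow> nat \<Rightarrow> real)"

definition dp_feasible ::
    "(real ^ 'd) set \<Rightarrow> nat \<Rightarrow> (nat \<Rightarrow> real \<times> (real ^ 'd)) \<Rightarrow> nat \<Rightarrow> nat \<Rightarrow> real
      \<Rightarrow> 'd dp_vars \<Rightarrow> bool" where
  "dp_feasible B n x r s M = (\<lambda>(\<beta>, \<epsilon>, z, \<theta>, w).
     (\<forall>i\<in>{1..n}. z i \<ge> 0) \<and>
     (\<forall>j\<in>{1..n}. \<theta> j \<ge> 0) \<and>
     (\<forall>i\<in>{1..n}. \<forall>j\<in>{1..n}. w i j \<in> {0, 1}) \<and>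
     (\<forall>i\<in>{1..n}. \<forall>j\<in>{1..n}. z i \<le> \<theta> j + M * (1 - w i j)) \<and>
     (\<forall>i\<in>{1..n}. z i ^ s \<ge> \<epsilon> i ^ r) \<and>
     (\<forall>j\<in>{1..n}. (\<Sum>i=1..n. w i j) = 1) \<and>
     (\<forall>i\<in>{1..n}. (\<Sum>j=1..n. w i j) = 1) \<and>
     (\<forall>j\<in>{2..n}. \<theta> j \<ge> \<theta> (j - 1)) \<and>
     (\<forall>i\<in>{1..n}. \<epsilon> i \<ge> inner \<beta> (x i)) \<and>
     (\<forall>i\<in>{1..n}. \<epsilon> i \<ge> - inner \<beta> (x i)) \<and>
     (\<forall>b\<in>extreme_points B. inner (snd \<beta>) b \<le> 1) \<and>
     (\<exists>b\<in>extreme_points B. inner (snd \<beta>) b = 1))"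

definition dp_objective :: "nat \<Rightarrow> (nat \<Rightarrow> real) \<Rightarrow> 'd dp_vars \<Rightarrow> real" where
  "dp_objective n lam = (\<lambda>(\<beta>, \<epsilon>, z, \<theta>, w). \<Sum>j=1..n. lam j * \<theta> j)"

text \<open>The minimum of f subject to P exists and equals v.\<close>

definition has_min_value :: "('a \<Rightarrow> real) \<Rightarrow> ('a \<Rightarrow> bool) \<Rightarrow> real \<Rightarrow> bool" where
  "has_min_value f P v \<longleftrightarrow> (\<exists>a. is_arg_min f P a \<and> f a = v)"

definition dp_equivalent ::
    "(real ^ 'd) set \<Rightarrow> nat \<Rightarrow> (nat \<Rightarrow> real \<times> (real ^ 'd)) \<Rightarrow> (nat \<Rightarrow> real) \<Rightarrow> real
      \<Rightarrow> nat \<Rightarrow> nat \<Rightarrow> real \<Rightarrow> bool" where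
  "dp_equivalent B n x lam p r s M \<longleftrightarrow>
     (\<exists>v. has_min_value (hyp_objective B n x lam p) hyp_feasible v \<and>
          has_min_value (dp_objective n lam) (dp_feasible B n x r s M) v) \<and>
     (\<forall>\<beta> \<epsilon> z \<theta> w.
        is_arg_min (dp_objective n lam) (dp_feasible B n x r s M) (\<beta>, \<epsilon>, z, \<theta>, w) \<longrightarrow>
        is_arg_min (hyp_objective B n x lam p) hyp_feasible \<beta>) \<and>
     (\<forall>\<beta>. is_arg_min (hyp_objective B n x lam p) hyp_feasible \<beta> \<longrightarrow>
        (\<exists>\<epsilon> z \<theta> w. is_arg_min (dp_objective n lam) (dp_feasible B n x r s M)
           ((1 / ball_norm (polar B) (snd \<beta>)) *\<^sub>R \<beta>, \<epsilon>, z, \<theta>, w)))"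

end

theory Submission
  imports Defs "HOL-Combinatorics.List_Permutation"
begin

text \<open>
  Since residuals are invariant under scaling of \<open>\<beta>\<close>, one may assume that
  \<open>\<beta>\<^sub>-\<^sub>0\<close> has polar norm 1, which means
  \<open>\<beta>\<^sub>-\<^sub>0 \<bullet> b \<le> 1\<close> on the extreme points with equality somewhere; the residuals are then
  \<open>\<bar>\<beta> \<bullet> x\<^sub>i\<bar>\<close>. The assignment \<open>w\<close> is a permutation matching \<open>z\<close> with the
  increasing \<open>\<theta>\<close>, so each \<open>\<theta>\<^sub>j\<close> dominates the j-th smallest \<open>z\<close>, whence the disjunctive
  objective is at least the ordered objective for every \<open>M\<close>. The sorted powers attain equality as
  soon as \<open>M\<close> bounds the powers of the residuals. Such a bound holds for all normalised optimal
  \<open>\<beta>\<close> at once: if some weight is positive, the objective is coercive in \<open>\<beta>\<^sub>0\<close>, which also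
  gives existence of a minimum.
\<close>

subsection \<open>Order statistics\<close>

definition order_stat :: "nat \<Rightarrow> (nat \<Rightarrow> real) \<Rightarrow> nat \<Rightarrow> real" where
  "order_stat n f j = sort (map f [1..<Suc n]) ! (j - 1)"

text \<open>Sorting preserves the multiset of values, so entries below a threshold may be counted
  over the indices instead. This transfer lets order statistics be handled by counting.\<close>

lemma card_filter_le:
  "length (filter (\<lambda>u. u \<le> t) (sort (map f [1..<Suc n]))) = card {i\<in>{1..n}. f i \<le> (t::real)}"
proof -
  have "length (filter (\<lambda>u. u \<le> t) (sort (map f [1..<Suc n])))
      = size (filter_mset (\<lambda>u. u \<le> t) (mset (sort (map f [1..<Suc n]))))"
    by (metis mset_filter size_mset)
  also have "\<dots> = length (filter (\<lambda>u. u \<le> t) (map f [1..<Suc n]))"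
    by (metis mset_filter mset_sort size_mset)
  also have "\<dots> = length (filter (\<lambda>i. f i \<le> t) [1..<Suc n])"
    by (simp add: filter_map o_def)
  also have "\<dots> = card (set (filter (\<lambda>i. f i \<le> t) [1..<Suc n]))"
    by (rule distinct_card[symmetric]) simp
  also have "set (filter (\<lambda>i. f i \<le> t) [1..<Suc n]) = {i\<in>{1..n}. f i \<le> t}"
    by auto
  finally show ?thesis .
qed

text \<open>If the j-th entry exceeded t, only the first j - 1 sorted positions could hold values at
  most t. With \<open>card_le_order_stat\<close> this characterises the j-th smallest value by
  counting, so later arguments need no sorted lists.\<close>

lemma order_stat_le:
  assumes j: "j \<in> {1..n}" and c: "j \<le> card {i\<in>{1..n}. f i \<le> t}"
  shows "order_stat n f j \<le> t"
proof (rule ccontr)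
  let ?L = "sort (map f [1..<Suc n])"
  assume "\<not> order_stat n f j \<le> t"
  then have big: "t < ?L ! (j - 1)" by (simp add: order_stat_def)
  have "k < j - 1" if "k < length ?L" "?L ! k \<le> t" for k
    using sorted_nth_mono[of ?L "j - 1" k] that big by force
  then have "{k. k < length ?L \<and> ?L ! k \<le> t} \<subseteq> {..<j - 1}" by auto
  then have "card {k. k < length ?L \<and> ?L ! k \<le> t} \<le> j - 1"
    using card_mono[of "{..<j - 1}"] by simp
  then have "length (filter (\<lambda>u. u \<le> t) ?L) \<le> j - 1"
    by (simp only: length_filter_conv_card)
  then have "card {i\<in>{1..n}. f i \<le> t} \<le> j - 1" by (simp only: card_filter_le)
  then show False using c j unfolding atLeastAtMost_iff by linarith
qed

lemma card_le_order_stat: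
  assumes j: "j \<in> {1..n}"
  shows "j \<le> card {i\<in>{1..n}. f i \<le> order_stat n f j}"
proof -
  let ?L = "sort (map f [1..<Suc n])"
  have "{..<j} \<subseteq> {k. k < length ?L \<and> ?L ! k \<le> order_stat n f j}"
    using j sorted_nth_mono[of ?L] by (auto simp: order_stat_def)
  then have "j \<le> card {k. k < length ?L \<and> ?L ! k \<le> order_stat n f j}"
    by (intro order_trans[OF eq_refl card_mono]) auto
  also have "\<dots> = card {i\<in>{1..n}. f i \<le> order_stat n f j}"
    by (rule card_filter_le[unfolded length_filter_conv_card])
  finally show ?thesis .
qed

lemma order_stat_eq_some:
  assumes "j \<in> {1..n}"
  obtains i where "i \<in> {1..n}" "order_stat n f j = f i"
proof -
  have "sort (map f [1..<Suc n]) ! (j - 1) \<in> set (sort (map f [1..<Suc n]))"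
    using assms by (intro nth_mem) auto
  then show ?thesis using that by (auto simp: order_stat_def less_Suc_eq_le simp del: upt_Suc)
qed

lemma order_stat_mono:
  assumes "1 \<le> i" "i \<le> j" "j \<le> n"
  shows "order_stat n f i \<le> order_stat n f j"
  unfolding order_stat_def using assms by (intro sorted_nth_mono) auto

text \<open>The \<sigma>-preimages of 1, ..., j are j indices at which f is at most g j, because g
  is increasing.\<close>

lemma order_stat_le_permuted:
  assumes \<sigma>: "bij_betw \<sigma> {1..n} {1..n}" and fg: "\<And>i. i \<in> {1..n} \<Longrightarrow> f i \<le> g (\<sigma> i)"
    and g: "\<And>i j. 1 \<le> i \<Longrightarrow> i \<le> j \<Longrightarrow> j \<le> n \<Longrightarrow> g i \<le> g j" and j: "j \<in> {1..n}"
  shows "order_stat n f j \<le> g j"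
proof (rule order_stat_le[OF j])
  have "{1..j} \<subseteq> \<sigma> ` {i\<in>{1..n}. f i \<le> g j}"
  proof
    fix k assume k: "k \<in> {1..j}"
    then have "k \<in> \<sigma> ` {1..n}" using \<sigma> j by (auto simp: bij_betw_def)
    then obtain i where i: "i \<in> {1..n}" "k = \<sigma> i" by blast
    then have "f i \<le> g j" using fg[of i] g[of k j] k j by force
    then show "k \<in> \<sigma> ` {i\<in>{1..n}. f i \<le> g j}" using i by blast
  qed
  then have "card {1..j} \<le> card (\<sigma> ` {i\<in>{1..n}. f i \<le> g j})" by (intro card_mono) auto
  also have "\<dots> \<le> card {i\<in>{1..n}. f i \<le> g j}" by (intro card_image_le) auto
  finally show "j \<le> card {i\<in>{1..n}. f i \<le> g j}" by simp
qed

text \<open>An index counted for g at its j-th value is counted for f at that value plus e. Used in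
  both directions, this makes an order statistic 1-Lipschitz for the maximum norm, hence
  continuous.\<close>

lemma order_stat_le_add:
  assumes "\<And>i. i \<in> {1..n} \<Longrightarrow> f i \<le> g i + e" and j: "j \<in> {1..n}"
  shows "order_stat n f j \<le> order_stat n g j + e"
proof (rule order_stat_le[OF j])
  have "j \<le> card {i\<in>{1..n}. g i \<le> order_stat n g j}" by (rule card_le_order_stat[OF j])
  also have "\<dots> \<le> card {i\<in>{1..n}. f i \<le> order_stat n g j + e}"
    using assms(1) by (intro card_mono) force+
  finally show "j \<le> card {i\<in>{1..n}. f i \<le> order_stat n g j + e}" .
qed

lemma continuous_on_order_stat:
  fixes f :: "'a::metric_space \<Rightarrow> nat \<Rightarrow> real"
  assumes f: "\<And>i. i \<in> {1..n} \<Longrightarrow> continuous_on S (\<lambda>b. f b i)" and j: "j \<in> {1..n}"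
  shows "continuous_on S (\<lambda>b. order_stat n (f b) j)"
  unfolding continuous_on_def
proof (intro ballI tendstoI)
  fix b and e :: real assume b: "b \<in> S" and e: "0 < e"
  \<comment> \<open>There are finitely many indices, so one neighbourhood serves them all. The bound
    e / 2 leaves room for the strict inequality after two non-strict estimates.\<close>
  have "\<forall>\<^sub>F a in at b within S. \<forall>i\<in>{1..n}. dist (f a i) (f b i) < e / 2"
    using f b e by (intro eventually_ball_finite ballI tendstoD) (auto simp: continuous_on_def)
  then show "\<forall>\<^sub>F a in at b within S. dist (order_stat n (f a) j) (order_stat n (f b) j) < e"
  proof eventually_elim
    case (elim a)
    have d: "f a i \<le> f b i + e / 2" "f b i \<le> f a i + e / 2" if "i \<in> {1..n}" for i
      using bspec[OF elim that] unfolding dist_real_def by linarith+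
    have "order_stat n (f a) j \<le> order_stat n (f b) j + e / 2"
      by (intro order_stat_le_add[OF _ j] d)
    moreover have "order_stat n (f b) j \<le> order_stat n (f a) j + e / 2"
      by (intro order_stat_le_add[OF _ j] d)
    ultimately show ?case using e by (simp add: dist_real_def)
  qed
qed

lemma order_stat_permutation:
  obtains \<sigma> where "bij_betw \<sigma> {1..n} {1..n}" "\<And>i. i \<in> {1..n} \<Longrightarrow> f i = order_stat n f (\<sigma> i)"
proof -
  let ?L = "map f [1..<Suc n]"
  have "mset ?L = mset (sort ?L)" by simp
  from permutation_Ex_bij[OF this] obtain h
    where h: "bij_betw h {..<length ?L} {..<length (sort ?L)}"
      and hn: "\<forall>i<length ?L. ?L ! i = sort ?L ! h i" by blast
  \<comment> \<open>List positions start at 0 and indices at 1, so the bijection \<open>h\<close> of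
    positions is conjugated by the shift.\<close>
  let ?s = "\<lambda>i. Suc (h (i - 1))"
  have 1: "bij_betw (\<lambda>i. i - 1) {1..n} {..<n}"
    by (rule bij_betw_byWitness[where f' = Suc]) auto
  have 2: "bij_betw h {..<n} {..<n}" using h by (simp del: upt_Suc)
  have 3: "bij_betw Suc {..<n} {1..n}"
    by (rule bij_betw_byWitness[where f' = "\<lambda>i. i - 1"]) auto
  have "bij_betw ?s {1..n} {1..n}"
    using bij_betw_trans[OF bij_betw_trans[OF 1 2] 3] by (simp add: o_def)
  moreover have "f i = order_stat n f (?s i)" if "i \<in> {1..n}" for i
    using hn[rule_format, of "i - 1"] that by (auto simp: order_stat_def nth_append simp del: upt_Suc)
  ultimately show ?thesis using that by blast
qed

text \<open>Both sides are nonnegative and may be raised to the power s, where (a powr p) ^ s = a ^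
  r. This turns the constraint between z and \<epsilon> into a bound by the p-th power.\<close>

lemma powr_le_iff_power_le:
  fixes a z :: real
  assumes "r > 0" "s > 0" "p = real r / real s" "0 \<le> a" "0 \<le> z"
  shows "a powr p \<le> z \<longleftrightarrow> a ^ r \<le> z ^ s"
proof -
  have "(a powr p) ^ s = a ^ r"
  proof (cases "a = 0")
    case False
    then have "(a powr p) ^ s = (a powr p) powr real s" using assms by (subst powr_realpow) auto
    also have "\<dots> = a powr real r" using assms by (simp add: powr_powr)
    finally show ?thesis using False assms by (simp add: powr_realpow)
  qed (use assms in \<open>simp add: power_0_left\<close>)
  then show ?thesis using assms power_mono_iff[of "a powr p" z s] by simp
qed

text \<open>A row sum 1 yields a column carrying a 1; column sums forbid choosing a column twice; an
  injective self-map of a finite set is bijective.\<close>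

lemma permutation_of_assignment:
  fixes w :: "nat \<Rightarrow> nat \<Rightarrow> real"
  assumes w: "\<And>i j. i \<in> {1..n} \<Longrightarrow> j \<in> {1..n} \<Longrightarrow> w i j \<in> {0, 1}"
    and col: "\<And>j. j \<in> {1..n} \<Longrightarrow> (\<Sum>i=1..n. w i j) = 1"
    and row: "\<And>i. i \<in> {1..n} \<Longrightarrow> (\<Sum>j=1..n. w i j) = 1"
  obtains \<sigma> where "bij_betw \<sigma> {1..n} {1..n}" "\<And>i. i \<in> {1..n} \<Longrightarrow> w i (\<sigma> i) = 1"
proof -
  have "\<exists>j\<in>{1..n}. w i j = 1" if "i \<in> {1..n}" for i
  proof (rule ccontr)
    assume "\<not> ?thesis"
    then have "(\<Sum>j=1..n. w i j) = 0" using w[OF that] by (intro sum.neutral) auto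
    then show False using row[OF that] by simp
  qed
  then obtain \<sigma> where \<sigma>: "\<And>i. i \<in> {1..n} \<Longrightarrow> \<sigma> i \<in> {1..n} \<and> w i (\<sigma> i) = 1" by metis
  have "inj_on \<sigma> {1..n}"
  proof (rule inj_onI, rule ccontr)
    fix a b assume ab: "a \<in> {1..n}" "b \<in> {1..n}" "\<sigma> a = \<sigma> b" "a \<noteq> b"
    \<comment> \<open>Two ones in the same column would already push its sum to 2.\<close>
    have "(\<Sum>i\<in>{a, b}. w i (\<sigma> a)) \<le> (\<Sum>i=1..n. w i (\<sigma> a))"
      using ab \<sigma>[of a] w[of _ "\<sigma> a"] by (intro sum_mono2) force+
    then show False using col[of "\<sigma> a"] \<sigma>[of a] \<sigma>[of b] ab by simp
  qed
  moreover have "\<sigma> ` {1..n} \<subseteq> {1..n}" using \<sigma> by auto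
  ultimately have "bij_betw \<sigma> {1..n} {1..n}"
    by (simp add: bij_betw_def endo_inj_surj)
  then show ?thesis using that \<sigma> by blast
qed

subsection \<open>Distances to hyperplanes in a polyhedral norm\<close>

lemma hyperplane_scaleR: "c \<noteq> 0 \<Longrightarrow> hyperplane (c *\<^sub>R \<beta>) = hyperplane \<beta>"
  by (simp only: hyperplane_def inner_scaleR_right mult_eq_0_iff simp_thms)

lemma residual_scaleR: "c \<noteq> 0 \<Longrightarrow> residual B (c *\<^sub>R \<beta>) x = residual B \<beta> x"
  by (simp add: residual_def hyperplane_scaleR)

lemma hyp_objective_scaleR:
  "c \<noteq> 0 \<Longrightarrow> hyp_objective B n x lam p (c *\<^sub>R \<beta>) = hyp_objective B n x lam p \<beta>"
  by (simp add: hyp_objective_def sorted_residual_def residual_scaleR)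

section \<open>Symmetric polytopes and vectors of polar norm 1\<close>

definition normalised :: "(real ^ 'd) set \<Rightarrow> real ^ 'd \<Rightarrow> bool" where
  "normalised B v \<longleftrightarrow>
    (\<forall>b\<in>extreme_points B. inner v b \<le> 1) \<and> (\<exists>b\<in>extreme_points B. inner v b = 1)"

locale symmetric_polytope =
  fixes B :: "(real ^ 'd) set"
  assumes polytope: "polytope B" and sym: "uminus ` B = B" and interior: "interior B \<noteq> {}"
begin

lemma convex: "convex B" and compact: "compact B"
  using polytope by (auto simp: polytope_imp_convex polytope_imp_compact)

lemma uminus_mem: "b \<in> B \<Longrightarrow> - b \<in> B"
  using sym by force

lemma zero_interior: "0 \<in> interior B"
proof -
  obtain u where u: "u \<in> interior B" using interior by blast
  then have "- u \<in> interior B"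
    using interior_negations[of B] sym by force
  then have "(1/2) *\<^sub>R u + (1/2) *\<^sub>R (- u) \<in> interior B"
    using u convex_interior[OF convex] by (intro convexD) auto
  then show ?thesis by simp
qed

lemma finite_extreme: "finite (extreme_points B)"
  unfolding extreme_points_def using polytope finite_polyhedron_extreme_points polytope_imp_polyhedron
  by blast

lemma hull_extreme: "convex hull (extreme_points B) = B"
  unfolding extreme_points_def using Krein_Milman_Minkowski[OF compact convex] by simp

lemma extreme_subset: "extreme_points B \<subseteq> B"
  by (metis hull_extreme hull_subset)

text \<open>A half-space is convex, so containing the extreme points it contains their hull, which
  is B.\<close>

lemma inner_le_of_extreme:
  assumes "u \<in> B" "\<And>b. b \<in> extreme_points B \<Longrightarrow> inner v b \<le> t"
  shows "inner v u \<le> t"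
proof -
  have "convex hull (extreme_points B) \<subseteq> {u. inner v u \<le> t}"
    using assms by (intro hull_minimal) (auto simp: convex_halfspace_le)
  then show ?thesis using assms hull_extreme by auto
qed

lemma small_ball: obtains e where "e > 0" "cball 0 e \<subseteq> B"
  using zero_interior by (auto simp: mem_interior_cball)

lemma normalised_nonzero: "normalised B v \<Longrightarrow> v \<noteq> 0"
  by (auto simp: normalised_def)

lemma normalised_norm_le:
  assumes "normalised B v" "cball 0 e \<subseteq> B" "e > 0"
  shows "norm v \<le> 1 / e"
proof -
  \<comment> \<open>Testing v against the point of B at distance e in its own direction gives e *
    norm v.\<close>
  have "(e / norm v) *\<^sub>R v \<in> B"
    using assms by (intro subsetD[OF assms(2)]) auto
  then have "inner v ((e / norm v) *\<^sub>R v) \<le> 1"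
    by (rule inner_le_of_extreme) (use assms in \<open>auto simp: normalised_def\<close>)
  then have "e * norm v \<le> 1"
    using normalised_nonzero[OF assms(1)] by (simp add: dot_square_norm power2_eq_square)
  then show ?thesis using assms by (simp add: field_simps)
qed

lemma support_value:
  assumes "v \<noteq> 0"
  obtains h where "h > 0" "\<And>b. b \<in> extreme_points B \<Longrightarrow> inner v b \<le> h"
    "\<exists>b\<in>extreme_points B. inner v b = h"
proof -
  let ?H = "inner v ` extreme_points B"
  have "extreme_points B \<noteq> {}" using hull_extreme zero_interior by auto
  then have "Max ?H \<in> ?H" using finite_extreme by (intro Max_in) auto
  moreover have le: "inner v b \<le> Max ?H" if "b \<in> extreme_points B" for b
    using that finite_extreme by auto
  moreover have "Max ?H > 0"
  proof -
    obtain e where e: "e > 0" "cball 0 e \<subseteq> B" by (rule small_ball)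
    have "(e / norm v) *\<^sub>R v \<in> B"
      using e assms by (intro subsetD[OF e(2)]) auto
    then have "inner v ((e / norm v) *\<^sub>R v) \<le> Max ?H"
      by (rule inner_le_of_extreme) (rule le)
    moreover have "inner v ((e / norm v) *\<^sub>R v) > 0"
      unfolding inner_scaleR_right using assms e by (intro mult_pos_pos) auto
    ultimately show ?thesis by linarith
  qed
  ultimately show ?thesis by (intro that[of "Max ?H"]) force+
qed

text \<open>The polar norm is the support function of B: for positive t, v lies in t times the polar
  iff t is at least the maximum h, so the infimum is over a closed half-line.\<close>

lemma ball_norm_polar_eq:
  assumes h: "h > 0" and le: "\<And>b. b \<in> extreme_points B \<Longrightarrow> inner v b \<le> h"
    and ex: "\<exists>b\<in>extreme_points B. inner v b = h"
  shows "ball_norm (polar B) v = h"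
proof -
  have "{t. t \<ge> 0 \<and> v \<in> (\<lambda>u. t *\<^sub>R u) ` polar B} = {h..}"
  proof safe
    fix t u assume t: "t \<ge> 0" "v = t *\<^sub>R u" "u \<in> polar B"
    from ex obtain b where b: "b \<in> extreme_points B" "inner v b = h" by blast
    then have "inner u b \<le> 1" using t by (auto simp: polar_def)
    then have "t * inner u b \<le> t" using t mult_left_le by blast
    then show "h \<le> t" using b t by simp
  next
    fix t assume t: "h \<le> t"
    have "inverse t *\<^sub>R v \<in> polar B"
      using le t h by (fastforce simp: polar_def field_simps)
    moreover have "v = t *\<^sub>R (inverse t *\<^sub>R v)" using t h by simp
    ultimately show "v \<in> (\<lambda>u. t *\<^sub>R u) ` polar B" by blast
  qed (use h in auto)
  then show ?thesis by (simp add: ball_norm_def)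
qed

lemma normalised_divide_ball_norm:
  assumes "v \<noteq> 0"
  shows "ball_norm (polar B) v > 0" "normalised B ((1 / ball_norm (polar B) v) *\<^sub>R v)"
proof -
  obtain h where h: "h > 0" "\<And>b. b \<in> extreme_points B \<Longrightarrow> inner v b \<le> h"
    "\<exists>b\<in>extreme_points B. inner v b = h"
    using support_value[OF assms] by metis
  have eq: "ball_norm (polar B) v = h" using h by (intro ball_norm_polar_eq)
  show "ball_norm (polar B) v > 0" using eq h by simp
  show "normalised B ((1 / ball_norm (polar B) v) *\<^sub>R v)"
    using h unfolding eq normalised_def by (intro conjI ballI) (auto simp del: One_nat_def)
qed

lemma ball_norm_le:
  assumes "t \<ge> 0" "u \<in> B"
  shows "ball_norm B (t *\<^sub>R u) \<le> t"
  unfolding ball_norm_def using assms by (intro cInf_lower bdd_belowI[of _ 0]) auto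

text \<open>Duality of the two norms: writing u as t times a point a of B, symmetry bounds inner v a
  by 1 in absolute value.\<close>

lemma inner_le_ball_norm:
  assumes "normalised B v"
  shows "\<bar>inner v u\<bar> \<le> ball_norm B u"
  unfolding ball_norm_def
proof (rule cInf_greatest)
  obtain e where e: "e > 0" "cball 0 e \<subseteq> B" by (rule small_ball)
  \<comment> \<open>The infimum of an empty set would be unspecified; the small ball supplies an
    admissible factor.\<close>
  have "norm u / e \<ge> 0 \<and> u \<in> (\<lambda>a. (norm u / e) *\<^sub>R a) ` B"
  proof (cases "u = 0")
    case True then show ?thesis using zero_interior interior_subset by force
  next
    case False
    have "(e / norm u) *\<^sub>R u \<in> B" using e by (intro subsetD[OF e(2)]) auto
    moreover have "u = (norm u / e) *\<^sub>R ((e / norm u) *\<^sub>R u)" using False e by simp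
    ultimately show ?thesis using e by (metis divide_nonneg_pos imageI norm_ge_zero)
  qed
  then show "{t. t \<ge> 0 \<and> u \<in> (\<lambda>a. t *\<^sub>R a) ` B} \<noteq> {}" by blast
next
  fix t assume "t \<in> {t. t \<ge> 0 \<and> u \<in> (\<lambda>a. t *\<^sub>R a) ` B}"
  then obtain a where a: "t \<ge> 0" "u = t *\<^sub>R a" "a \<in> B" by auto
  have "inner v a \<le> 1" "inner v (- a) \<le> 1"
    using assms a uminus_mem by (auto intro: inner_le_of_extreme simp: normalised_def simp del: inner_minus_right)
  then have "\<bar>inner v a\<bar> \<le> 1" by simp
  then show "\<bar>inner v u\<bar> \<le> t" using a by (simp add: abs_mult mult_left_le)
qed

text \<open>Duality bounds every distance to the hyperplane from below. The bound is attained by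
  moving along an extreme point b with inner product 1, so that a step of length c cancels c
  exactly.\<close>

lemma residual_normalised:
  assumes v: "normalised B (snd \<beta>)" and x: "fst x = 1"
  shows "residual B \<beta> x = \<bar>inner \<beta> x\<bar>"
  unfolding residual_def
proof (rule cInf_eq_minimum)
  obtain b where b: "b \<in> extreme_points B" "inner (snd \<beta>) b = 1"
    using v by (auto simp: normalised_def)
  define c where "c = inner \<beta> x"
  define y where "y = snd x - c *\<^sub>R b"
  have c: "c = fst \<beta> + inner (snd \<beta>) (snd x)" using x by (simp add: c_def inner_prod_def)
  have y: "y \<in> hyperplane \<beta>"
    using b c by (simp add: hyperplane_def y_def inner_prod_def inner_diff_right inner_diff_left inner_commute)
  then have ge: "\<bar>c\<bar> \<le> ball_norm B (snd x - y)" if "y \<in> hyperplane \<beta>" for y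
  proof -
    have "inner (snd \<beta>) (snd x - y) = c"
      using that c by (simp add: hyperplane_def inner_prod_def inner_diff_right inner_commute)
    then show ?thesis using inner_le_ball_norm[OF v, of "snd x - y"] by simp
  qed
  \<comment> \<open>For negative c the step uses - b, which is in B by symmetry.\<close>
  have "snd x - y = \<bar>c\<bar> *\<^sub>R (if c \<ge> 0 then b else - b)" by (simp add: y_def)
  then have "ball_norm B (snd x - y) \<le> \<bar>c\<bar>"
    using b extreme_subset uminus_mem by (simp only:) (rule ball_norm_le, auto)
  then have "ball_norm B (snd x - y) = \<bar>c\<bar>" using ge[OF y] by simp
  then show "\<bar>inner \<beta> x\<bar> \<in> (\<lambda>y. ball_norm B (snd x - y)) ` hyperplane \<beta>"
    using y c_def by (intro image_eqI[of _ _ y]) auto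
  show "\<bar>inner \<beta> x\<bar> \<le> t" if "t \<in> (\<lambda>y. ball_norm B (snd x - y)) ` hyperplane \<beta>" for t
    using that ge c_def by auto
qed

lemma sorted_residual_normalised:
  assumes "normalised B (snd \<beta>)" "\<And>i. i \<in> {1..n} \<Longrightarrow> fst (x i) = 1"
  shows "sorted_residual B n x \<beta> j = order_stat n (\<lambda>i. \<bar>inner \<beta> (x i)\<bar>) j"
proof -
  have "map (\<lambda>k. residual B \<beta> (x k)) [1..<Suc n] = map (\<lambda>i. \<bar>inner \<beta> (x i)\<bar>) [1..<Suc n]"
    using assms by (intro map_cong) (auto intro!: residual_normalised)
  then show ?thesis by (simp only: sorted_residual_def order_stat_def)
qed

lemma hyp_objective_normalised:
  assumes "normalised B (snd \<beta>)" "\<And>i. i \<in> {1..n} \<Longrightarrow> fst (x i) = 1"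
  shows "hyp_objective B n x lam p \<beta> = (\<Sum>j=1..n. lam j * order_stat n (\<lambda>i. \<bar>inner \<beta> (x i)\<bar>) j powr p)"
proof -
  have "sorted_residual B n x \<beta> j = order_stat n (\<lambda>i. \<bar>inner \<beta> (x i)\<bar>) j" for j
    using assms by (rule sorted_residual_normalised)
  then show ?thesis by (simp only: hyp_objective_def)
qed

lemma compact_normalised:
  "compact {\<beta> :: real \<times> (real ^ 'd). normalised B (snd \<beta>) \<and> \<bar>fst \<beta>\<bar> \<le> R}" (is "compact ?K")
proof -
  obtain e where e: "e > 0" "cball 0 e \<subseteq> B" by (rule small_ball)
  have "?K \<subseteq> {-R..R} \<times> cball 0 (1 / e)"
    using normalised_norm_le e by force
  then have bdd: "bounded ?K"
    by (rule bounded_subset[rotated]) (intro bounded_Times bounded_cball bounded_closed_interval)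
  have "closed {\<beta> :: real \<times> (real ^ 'd). inner (snd \<beta>) b = 1}" for b
    by (intro closed_Collect_eq continuous_intros)
  moreover have "closed {\<beta> :: real \<times> (real ^ 'd). inner (snd \<beta>) b \<le> 1}" for b
    by (intro closed_Collect_le continuous_intros)
  moreover have "closed {\<beta> :: real \<times> (real ^ 'd). \<bar>fst \<beta>\<bar> \<le> R}"
    by (intro closed_Collect_le continuous_intros)
  \<comment> \<open>The disjunction becomes a union over finitely many extreme points, hence stays
    closed.\<close>
  moreover have "?K = (\<Inter>b\<in>extreme_points B. {\<beta>. inner (snd \<beta>) b \<le> 1})
      \<inter> (\<Union>b\<in>extreme_points B. {\<beta>. inner (snd \<beta>) b = 1}) \<inter> {\<beta>. \<bar>fst \<beta>\<bar> \<le> R}"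
    by (auto simp: normalised_def)
  ultimately have "closed ?K"
    using finite_extreme by (simp only:) (intro closed_Int closed_INT closed_UN ballI)
  then show ?thesis using bdd compact_eq_bounded_closed by blast
qed

end

lemma dp_feasible_normalised: "dp_feasible B n x r s M (\<beta>, \<epsilon>, z, \<theta>, w) \<Longrightarrow> normalised B (snd \<beta>)"
  by (simp add: dp_feasible_def normalised_def)

subsection \<open>Equivalence of the two programs\<close>

locale hyperplane_problem = symmetric_polytope B for B :: "(real ^ 'd) set" +
  fixes n r s :: nat and p :: real
    and x :: "nat \<Rightarrow> real \<times> (real ^ 'd)" and lam :: "nat \<Rightarrow> real"
  assumes x: "\<And>i. i \<in> {1..n} \<Longrightarrow> fst (x i) = 1"
    and lam: "\<And>i. i \<in> {1..n} \<Longrightarrow> lam i \<ge> 0"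
    and r: "r > 0" and s: "s > 0" and p: "p = real r / real s"
begin

section \<open>Comparison of the two objectives\<close>

abbreviation H where "H \<equiv> hyp_objective B n x lam p"
abbreviation dist_stat where "dist_stat \<beta> \<equiv> order_stat n (\<lambda>i. \<bar>inner \<beta> (x i)\<bar>)"

lemma p_pos: "p > 0"
  using r s p by simp

lemma hyp_objective_eq:
  assumes "normalised B (snd \<beta>)"
  shows "H \<beta> = (\<Sum>j=1..n. lam j * dist_stat \<beta> j powr p)"
  using assms x by (rule hyp_objective_normalised)

lemma dist_stat_nonneg: "j \<in> {1..n} \<Longrightarrow> 0 \<le> dist_stat \<beta> j"
  by (metis abs_ge_zero order_stat_eq_some)

lemma hyp_objective_le_dp_objective:
  assumes f: "dp_feasible B n x r s M (\<beta>, \<epsilon>, z, \<theta>, w)"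
  shows "H \<beta> \<le> dp_objective n lam (\<beta>, \<epsilon>, z, \<theta>, w)"
proof -
  have \<theta>: "\<theta> j \<ge> 0" if "j \<in> {1..n}" for j using f that by (simp add: dp_feasible_def)
  have incr: "\<theta> j \<ge> \<theta> (j - 1)" if "j \<in> {2..n}" for j using f that by (simp add: dp_feasible_def)
  have mono: "\<theta> i \<le> \<theta> j" if "1 \<le> i" "i \<le> j" "j \<le> n" for i j
    using that(2,3)
  proof (induction j rule: dec_induct)
    case (step k)
    then have "\<theta> (Suc k) \<ge> \<theta> (Suc k - 1)" using \<open>1 \<le> i\<close> by (intro incr) auto
    then show ?case using step by simp
  qed simp
  have "w i j \<in> {0, 1}" if "i \<in> {1..n}" "j \<in> {1..n}" for i j
    using f that by (simp add: dp_feasible_def)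
  moreover have "(\<Sum>i=1..n. w i j) = 1" if "j \<in> {1..n}" for j
    using f that by (simp add: dp_feasible_def)
  moreover have "(\<Sum>j=1..n. w i j) = 1" if "i \<in> {1..n}" for i
    using f that by (simp add: dp_feasible_def)
  ultimately obtain \<sigma> where \<sigma>: "bij_betw \<sigma> {1..n} {1..n}"
    and w1: "\<And>i. i \<in> {1..n} \<Longrightarrow> w i (\<sigma> i) = 1"
    by (rule permutation_of_assignment) (assumption | rule that)+
  \<comment> \<open>Taking p-th roots of \<theta> compares it with the distances themselves, so
    sorting never has to be commuted with the power.\<close>
  have le: "\<bar>inner \<beta> (x i)\<bar> \<le> \<theta> (\<sigma> i) powr (1 / p)" if i: "i \<in> {1..n}" for i
  proof -
    let ?a = "\<bar>inner \<beta> (x i)\<bar>"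
    have \<sigma>i: "\<sigma> i \<in> {1..n}" using \<sigma> i by (rule bij_betwE[rule_format])
    have z: "z i \<ge> 0" and e: "?a \<le> \<epsilon> i" and ze: "\<epsilon> i ^ r \<le> z i ^ s"
      using f i by (auto simp: dp_feasible_def abs_le_iff)
    have "z i \<le> \<theta> (\<sigma> i) + M * (1 - w i (\<sigma> i))"
      using f i \<sigma>i by (simp add: dp_feasible_def)
    \<comment> \<open>The term with M vanishes where w is 1, so no condition on M enters.\<close>
    then have "z i \<le> \<theta> (\<sigma> i)" using w1[OF i] by simp
    moreover have "?a ^ r \<le> z i ^ s" using power_mono[OF e, of r] ze by simp
    then have "?a powr p \<le> z i" using powr_le_iff_power_le[OF r s p _ z] by simp
    ultimately have "(?a powr p) powr (1 / p) \<le> \<theta> (\<sigma> i) powr (1 / p)"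
      using p_pos by (intro powr_mono2) auto
    then show ?thesis using p_pos by (simp add: powr_powr)
  qed
  have "dist_stat \<beta> j powr p \<le> \<theta> j" if j: "j \<in> {1..n}" for j
  proof -
    have "dist_stat \<beta> j \<le> \<theta> j powr (1 / p)"
    proof (rule order_stat_le_permuted[where g = "\<lambda>j. \<theta> j powr (1 / p)", OF \<sigma> _ _ j])
      show "\<bar>inner \<beta> (x i)\<bar> \<le> \<theta> (\<sigma> i) powr (1 / p)" if "i \<in> {1..n}" for i
        using that by (rule le)
      fix i j assume "1 \<le> i" "i \<le> j" "j \<le> n"
      then show "\<theta> i powr (1 / p) \<le> \<theta> j powr (1 / p)"
        using mono[of i j] \<theta>[of i] p_pos by (intro powr_mono2) auto
    qed
    then have "dist_stat \<beta> j powr p \<le> (\<theta> j powr (1 / p)) powr p"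
      using p_pos dist_stat_nonneg[OF j] by (intro powr_mono2) auto
    then show ?thesis using p_pos \<theta>[OF j] by (simp add: powr_powr)
  qed
  then have "(\<Sum>j=1..n. lam j * dist_stat \<beta> j powr p) \<le> (\<Sum>j=1..n. lam j * \<theta> j)"
    using lam by (intro sum_mono mult_left_mono) auto
  then show ?thesis
    using hyp_objective_eq[OF dp_feasible_normalised[OF f]] by (simp add: dp_objective_def)
qed

text \<open>Both \<sigma> and \<theta> are left general, to cover the sorted powers as well as a
  constant \<theta>. Nonnegativity of \<theta> follows because every j is some \<sigma> i.\<close>

lemma dp_feasible_assignment:
  assumes v: "normalised B (snd \<beta>)" and \<sigma>: "bij_betw \<sigma> {1..n} {1..n}"
    and \<theta>: "\<And>i. i \<in> {1..n} \<Longrightarrow> \<bar>inner \<beta> (x i)\<bar> powr p \<le> \<theta> (\<sigma> i)"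
    and M: "\<And>i j. i \<in> {1..n} \<Longrightarrow> j \<in> {1..n} \<Longrightarrow> \<bar>inner \<beta> (x i)\<bar> powr p \<le> \<theta> j + M"
    and mono: "\<And>i j. 1 \<le> i \<Longrightarrow> i \<le> j \<Longrightarrow> j \<le> n \<Longrightarrow> \<theta> i \<le> \<theta> j"
  shows "dp_feasible B n x r s M (\<beta>, \<lambda>i. \<bar>inner \<beta> (x i)\<bar>, \<lambda>i. \<bar>inner \<beta> (x i)\<bar> powr p, \<theta>,
    \<lambda>i j. of_bool (\<sigma> i = j))"
proof -
  have nonneg: "0 \<le> \<theta> j" if "j \<in> {1..n}" for j
  proof -
    have "j \<in> \<sigma> ` {1..n}" using \<sigma> that by (simp add: bij_betw_def)
    then obtain i where "i \<in> {1..n}" "j = \<sigma> i" by blast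
    then show ?thesis using \<theta>[of i] by (metis order_trans powr_ge_zero)
  qed
  have row: "(\<Sum>j=1..n. of_bool (\<sigma> i = j)) = (1::real)" if "i \<in> {1..n}" for i
    using bij_betwE[OF \<sigma>] that by (simp add: of_bool_def)
  have col: "(\<Sum>i=1..n. of_bool (\<sigma> i = j)) = (1::real)" if "j \<in> {1..n}" for j
    using sum.reindex_bij_betw[OF \<sigma>, of "\<lambda>k. of_bool (k = j) :: real"] that by (simp add: of_bool_def)
  have "\<bar>inner \<beta> (x i)\<bar> powr p \<le> \<theta> j + M * (1 - of_bool (\<sigma> i = j))"
    if "i \<in> {1..n}" "j \<in> {1..n}" for i j
    using \<theta>[OF that(1)] M[OF that] by auto
  moreover have "\<bar>inner \<beta> (x i)\<bar> ^ r \<le> (\<bar>inner \<beta> (x i)\<bar> powr p) ^ s" for i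
    using powr_le_iff_power_le[OF r s p] by (metis abs_ge_zero order_refl powr_ge_zero)
  moreover have "\<theta> (j - 1) \<le> \<theta> j" if "j \<in> {2..n}" for j
    using that by (intro mono) auto
  moreover have "\<And>i. inner \<beta> (x i) \<le> \<bar>inner \<beta> (x i)\<bar>" "\<And>i. - inner \<beta> (x i) \<le> \<bar>inner \<beta> (x i)\<bar>"
    by auto
  ultimately show ?thesis
    using v nonneg row col unfolding dp_feasible_def normalised_def prod.case by (intro conjI ballI) auto
qed

text \<open>Since H never exceeds the disjunctive objective, it suffices to lift optimal normalised
  \<beta> with equal value. Lifting is demanded only for those, as M need only control their
  residuals.\<close>

lemma dp_equivalentI:
  assumes opt: "is_arg_min H hyp_feasible \<beta>0"
    and lift: "\<And>\<beta>. is_arg_min H hyp_feasible \<beta> \<Longrightarrow> normalised B (snd \<beta>) \<Longrightarrow>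
      \<exists>\<epsilon> z \<theta> w. dp_feasible B n x r s M (\<beta>, \<epsilon>, z, \<theta>, w) \<and> dp_objective n lam (\<beta>, \<epsilon>, z, \<theta>, w) = H \<beta>"
  shows "dp_equivalent B n x lam p r s M"
proof -
  let ?D = "dp_objective n lam" and ?F = "dp_feasible B n x r s M"
  let ?nrm = "\<lambda>\<beta> :: real \<times> (real ^ 'd). (1 / ball_norm (polar B) (snd \<beta>)) *\<^sub>R \<beta>"
  have lower: "H \<beta> \<le> ?D (\<beta>', \<epsilon>, z, \<theta>, w)"
    if "is_arg_min H hyp_feasible \<beta>" "?F (\<beta>', \<epsilon>, z, \<theta>, w)" for \<beta> \<beta>' \<epsilon> z \<theta> w
  proof -
    have "hyp_feasible \<beta>'"
      using dp_feasible_normalised[OF that(2)] normalised_nonzero by (auto simp: hyp_feasible_def)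
    then have "H \<beta> \<le> H \<beta>'" using that(1) unfolding is_arg_min_linorder by blast
    then show ?thesis using hyp_objective_le_dp_objective[OF that(2)] by linarith
  qed
  have attain: "\<exists>\<epsilon> z \<theta> w. is_arg_min ?D ?F (?nrm \<beta>, \<epsilon>, z, \<theta>, w) \<and> ?D (?nrm \<beta>, \<epsilon>, z, \<theta>, w) = H \<beta>"
    if \<beta>: "is_arg_min H hyp_feasible \<beta>" for \<beta>
  proof -
    have v: "snd \<beta> \<noteq> 0" using \<beta> by (auto simp: is_arg_min_def hyp_feasible_def)
    note pos = normalised_divide_ball_norm(1)[OF v]
    have eq: "H (?nrm \<beta>) = H \<beta>" using pos by (intro hyp_objective_scaleR) simp
    have arg: "is_arg_min H hyp_feasible (?nrm \<beta>)"
      using \<beta> eq pos v by (auto simp: is_arg_min_def hyp_feasible_def)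
    have "normalised B (snd (?nrm \<beta>))" using normalised_divide_ball_norm(2)[OF v] by simp
    from lift[OF arg this] obtain \<epsilon> z \<theta> w
      where "?F (?nrm \<beta>, \<epsilon>, z, \<theta>, w)" "?D (?nrm \<beta>, \<epsilon>, z, \<theta>, w) = H \<beta>"
      unfolding eq by blast
    moreover from this have "is_arg_min ?D ?F (?nrm \<beta>, \<epsilon>, z, \<theta>, w)"
      unfolding is_arg_min_linorder using lower[OF \<beta>] by auto
    ultimately show ?thesis by blast
  qed
  show ?thesis unfolding dp_equivalent_def
  proof (intro conjI allI impI)
    show "\<exists>v. has_min_value H hyp_feasible v \<and> has_min_value ?D ?F v"
      unfolding has_min_value_def using opt attain[OF opt] by blast
  next
    fix \<beta> \<epsilon> z \<theta> w assume q: "is_arg_min ?D ?F (\<beta>, \<epsilon>, z, \<theta>, w)"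
    then have f: "?F (\<beta>, \<epsilon>, z, \<theta>, w)" by (simp add: is_arg_min_def)
    \<comment> \<open>The lift of \<open>\<beta>0\<close> shows that the disjunctive minimum is at
      most the minimum of H.\<close>
    obtain q0 where "?F q0" "?D q0 = H \<beta>0"
      using attain[OF opt] unfolding is_arg_min_def by blast
    then have "?D (\<beta>, \<epsilon>, z, \<theta>, w) \<le> H \<beta>0" using q unfolding is_arg_min_linorder by metis
    then have "H \<beta> \<le> H \<beta>0" using hyp_objective_le_dp_objective[OF f] by linarith
    moreover have "hyp_feasible \<beta>"
      using dp_feasible_normalised[OF f] normalised_nonzero by (auto simp: hyp_feasible_def)
    ultimately show "is_arg_min H hyp_feasible \<beta>"
      using opt unfolding is_arg_min_linorder by (meson order_trans)
  next
    fix \<beta> assume "is_arg_min H hyp_feasible \<beta>"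
    then show "\<exists>\<epsilon> z \<theta> w. is_arg_min ?D ?F (?nrm \<beta>, \<epsilon>, z, \<theta>, w)" using attain by blast
  qed
qed

section \<open>Existence of optima and the choice of M\<close>

lemma normalised_exists: obtains v where "normalised B v"
proof -
  have "(axis undefined 1 :: real ^ 'd) \<noteq> 0" by (simp add: axis_eq_0_iff)
  then show ?thesis using that normalised_divide_ball_norm(2) by blast
qed

text \<open>Without a positive weight every \<open>\<beta>\<close> is optimal, so no \<open>M\<close> dominates the residuals of all
  optimal \<open>\<beta>\<close>; a constant \<open>\<theta>\<close> makes the constraints involving \<open>M\<close> harmless.\<close>

lemma dp_equivalent_zero_weights:
  assumes zero: "\<And>j. j \<in> {1..n} \<Longrightarrow> lam j = 0" and M: "M \<ge> 0"
  shows "dp_equivalent B n x lam p r s M"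
proof -
  have H0: "H \<beta> = 0" for \<beta> using zero by (simp add: hyp_objective_def)
  obtain v where "normalised B v" by (rule normalised_exists)
  then have "is_arg_min H hyp_feasible (0, v)"
    using normalised_nonzero by (auto simp: is_arg_min_def hyp_feasible_def H0)
  then show ?thesis
  proof (rule dp_equivalentI)
    fix \<beta> :: "real \<times> (real ^ 'd)" assume v: "normalised B (snd \<beta>)"
    \<comment> \<open>One constant above all n powers; with zero weights its size costs nothing, and
      any permutation will do.\<close>
    define T where "T = (\<Sum>i=1..n. \<bar>inner \<beta> (x i)\<bar> powr p)"
    have T: "\<bar>inner \<beta> (x i)\<bar> powr p \<le> T" if "i \<in> {1..n}" for i
      unfolding T_def using that by (intro member_le_sum) auto
    have "\<bar>inner \<beta> (x i)\<bar> powr p \<le> T + M" if "i \<in> {1..n}" for i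
      using T[OF that] M by simp
    then have "dp_feasible B n x r s M (\<beta>, \<lambda>i. \<bar>inner \<beta> (x i)\<bar>, \<lambda>i. \<bar>inner \<beta> (x i)\<bar> powr p, \<lambda>_. T,
        \<lambda>i j. of_bool (id i = j))"
      using T by (intro dp_feasible_assignment[OF v bij_betw_id]) auto
    moreover have "dp_objective n lam (\<beta>, \<lambda>i. \<bar>inner \<beta> (x i)\<bar>, \<lambda>i. \<bar>inner \<beta> (x i)\<bar> powr p, \<lambda>_. T,
        \<lambda>i j. of_bool (id i = j)) = H \<beta>"
      using zero H0 by (simp add: dp_objective_def)
    ultimately show "\<exists>\<epsilon> z \<theta> w. dp_feasible B n x r s M (\<beta>, \<epsilon>, z, \<theta>, w) \<and>
        dp_objective n lam (\<beta>, \<epsilon>, z, \<theta>, w) = H \<beta>" by blast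
  qed
qed

text \<open>The sorted powers serve as \<theta>, with w matching each index to its rank. Where w is
  0, the bound M suffices because \<theta> is nonnegative.\<close>

lemma dp_equivalent_bounded:
  assumes opt: "is_arg_min H hyp_feasible \<beta>0"
    and M: "\<And>\<beta> i. is_arg_min H hyp_feasible \<beta> \<Longrightarrow> normalised B (snd \<beta>) \<Longrightarrow> i \<in> {1..n} \<Longrightarrow>
      \<bar>inner \<beta> (x i)\<bar> powr p \<le> M"
  shows "dp_equivalent B n x lam p r s M"
proof (rule dp_equivalentI[OF opt])
  fix \<beta> :: "real \<times> (real ^ 'd)" assume \<beta>: "is_arg_min H hyp_feasible \<beta>" and v: "normalised B (snd \<beta>)"
  let ?\<theta> = "\<lambda>j. dist_stat \<beta> j powr p"
  obtain \<sigma> where \<sigma>: "bij_betw \<sigma> {1..n} {1..n}"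
    and eq: "\<And>i. i \<in> {1..n} \<Longrightarrow> \<bar>inner \<beta> (x i)\<bar> = dist_stat \<beta> (\<sigma> i)"
    by (rule order_stat_permutation[where f = "\<lambda>i. \<bar>inner \<beta> (x i)\<bar>" and n = n]) blast
  have "dp_feasible B n x r s M (\<beta>, \<lambda>i. \<bar>inner \<beta> (x i)\<bar>, \<lambda>i. \<bar>inner \<beta> (x i)\<bar> powr p, ?\<theta>,
      \<lambda>i j. of_bool (\<sigma> i = j))"
  proof (rule dp_feasible_assignment[OF v \<sigma>])
    show "\<bar>inner \<beta> (x i)\<bar> powr p \<le> ?\<theta> (\<sigma> i)" if "i \<in> {1..n}" for i
      by (subst eq[OF that]) simp
    show "\<bar>inner \<beta> (x i)\<bar> powr p \<le> ?\<theta> j + M" if "i \<in> {1..n}" for i j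
      using M[OF \<beta> v that] powr_ge_zero[of "dist_stat \<beta> j" p] by linarith
    show "?\<theta> i \<le> ?\<theta> j" if "1 \<le> i" "i \<le> j" "j \<le> n" for i j
      using that p_pos dist_stat_nonneg[of i] by (intro powr_mono2 order_stat_mono) auto
  qed
  moreover have "dp_objective n lam (\<beta>, \<lambda>i. \<bar>inner \<beta> (x i)\<bar>, \<lambda>i. \<bar>inner \<beta> (x i)\<bar> powr p, ?\<theta>,
      \<lambda>i j. of_bool (\<sigma> i = j)) = H \<beta>"
    by (simp only: dp_objective_def prod.case hyp_objective_eq[OF v])
  ultimately show "\<exists>\<epsilon> z \<theta> w. dp_feasible B n x r s M (\<beta>, \<epsilon>, z, \<theta>, w) \<and>
      dp_objective n lam (\<beta>, \<epsilon>, z, \<theta>, w) = H \<beta>" by blast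
qed

text \<open>A bound on one order statistic bounds one distance, and with it the offset \<^term>\<open>fst \<beta>\<close>.\<close>

lemma offset_bounded:
  assumes k: "k \<in> {1..n}" "lam k > 0"
  obtains R where "\<And>\<beta>. normalised B (snd \<beta>) \<Longrightarrow> H \<beta> \<le> C \<Longrightarrow> \<bar>fst \<beta>\<bar> \<le> R"
proof -
  obtain e where e: "e > 0" "cball 0 e \<subseteq> B" by (rule small_ball)
  define X where "X = (\<Sum>i=1..n. norm (snd (x i)))"
  \<comment> \<open>The first term bounds the k-th distance; the second bounds the inner product
    with the point attaining it, as 1 / e bounds \<open>norm (snd \<beta>)\<close>.\<close>
  have "\<bar>fst \<beta>\<bar> \<le> (C / lam k) powr (1 / p) + 1 / e * X"
    if v: "normalised B (snd \<beta>)" and C: "H \<beta> \<le> C" for \<beta>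
  proof -
    have "lam k * dist_stat \<beta> k powr p \<le> (\<Sum>j=1..n. lam j * dist_stat \<beta> j powr p)"
      using k lam by (intro member_le_sum) auto
    then have "dist_stat \<beta> k powr p \<le> C / lam k"
      using C k hyp_objective_eq[OF v] by (simp add: field_simps)
    then have "(dist_stat \<beta> k powr p) powr (1 / p) \<le> (C / lam k) powr (1 / p)"
      using p_pos by (intro powr_mono2) auto
    then have d: "dist_stat \<beta> k \<le> (C / lam k) powr (1 / p)"
      using p_pos dist_stat_nonneg[OF k(1), of \<beta>] by (simp add: powr_powr)
    obtain i where i: "i \<in> {1..n}" "dist_stat \<beta> k = \<bar>inner \<beta> (x i)\<bar>"
      using order_stat_eq_some[OF k(1)] by metis
    have "norm (snd (x i)) \<le> X" unfolding X_def using i by (intro member_le_sum) auto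
    then have "norm (snd \<beta>) * norm (snd (x i)) \<le> 1 / e * X"
      using normalised_norm_le[OF v e(2,1)] e by (intro mult_mono) auto
    then have "\<bar>inner (snd \<beta>) (snd (x i))\<bar> \<le> 1 / e * X"
      using Cauchy_Schwarz_ineq2 order_trans by blast
    moreover have "inner \<beta> (x i) = fst \<beta> + inner (snd \<beta>) (snd (x i))"
      using x[OF i(1)] by (simp add: inner_prod_def)
    ultimately show ?thesis using d i by linarith
  qed
  then show ?thesis using that by blast
qed

lemma continuous_on_hyp_objective:
  "continuous_on {\<beta>. normalised B (snd \<beta>)} H"
proof -
  have "continuous_on {\<beta>. normalised B (snd \<beta>)} (\<lambda>\<beta>. \<Sum>j=1..n. lam j * dist_stat \<beta> j powr p)"
    using p_pos dist_stat_nonneg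
    by (intro continuous_intros continuous_on_powr' continuous_on_order_stat) auto
  then show ?thesis by (rule continuous_on_eq) (simp add: hyp_objective_eq)
qed

text \<open>After rescaling, every \<beta> at least as good as (0, v) lies in a compact set, where
  continuity gives a minimum. The same R bounds the offsets of all normalised optima.\<close>

lemma hyp_optimum_exists:
  assumes k: "k \<in> {1..n}" "lam k > 0"
  obtains \<beta>0 R where "is_arg_min H hyp_feasible \<beta>0"
    "\<And>\<beta>. is_arg_min H hyp_feasible \<beta> \<Longrightarrow> normalised B (snd \<beta>) \<Longrightarrow> \<bar>fst \<beta>\<bar> \<le> R"
proof -
  obtain v where v: "normalised B v" by (rule normalised_exists)
  let ?C = "H (0, v)"
  obtain R where R: "\<And>\<beta>. normalised B (snd \<beta>) \<Longrightarrow> H \<beta> \<le> ?C \<Longrightarrow> \<bar>fst \<beta>\<bar> \<le> R"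
    using offset_bounded[OF k] by blast
  let ?K = "{\<beta> :: real \<times> (real ^ 'd). normalised B (snd \<beta>) \<and> \<bar>fst \<beta>\<bar> \<le> R}"
  have vK: "(0, v) \<in> ?K" using v R[of "(0, v)"] by auto
  have "continuous_on ?K H" by (rule continuous_on_subset[OF continuous_on_hyp_objective]) auto
  then obtain \<beta>0 where \<beta>0: "\<beta>0 \<in> ?K" "\<And>\<beta>. \<beta> \<in> ?K \<Longrightarrow> H \<beta>0 \<le> H \<beta>"
    using continuous_attains_inf[OF compact_normalised] vK by blast
  have "H \<beta>0 \<le> H \<beta>" if "hyp_feasible \<beta>" for \<beta>
  proof (cases "H \<beta> \<le> ?C")
    case True
    let ?\<beta>' = "(1 / ball_norm (polar B) (snd \<beta>)) *\<^sub>R \<beta>"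
    have nz: "snd \<beta> \<noteq> 0" using that by (simp add: hyp_feasible_def)
    have eq: "H ?\<beta>' = H \<beta>"
      using normalised_divide_ball_norm(1)[OF nz] by (intro hyp_objective_scaleR) simp
    have n: "normalised B (snd ?\<beta>')" using normalised_divide_ball_norm(2)[OF nz] by simp
    have "H ?\<beta>' \<le> ?C" using eq True by linarith
    then have "?\<beta>' \<in> ?K" using n R[OF n] by blast
    then show ?thesis using \<beta>0(2) eq by metis
  next
    case False
    \<comment> \<open>A \<beta> worse than (0, v) is also worse than the minimum over ?K, which
      contains (0, v).\<close>
    then show ?thesis using \<beta>0(2)[OF vK] by linarith
  qed
  then have "is_arg_min H hyp_feasible \<beta>0"
    using \<beta>0(1) normalised_nonzero unfolding is_arg_min_linorder by (auto simp: hyp_feasible_def)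
  moreover have "\<bar>fst \<beta>\<bar> \<le> R" if "is_arg_min H hyp_feasible \<beta>" "normalised B (snd \<beta>)" for \<beta>
  proof (rule R[OF that(2)])
    have "hyp_feasible (0, v)" using normalised_nonzero[OF v] by (simp add: hyp_feasible_def)
    then show "H \<beta> \<le> ?C" using that(1) unfolding is_arg_min_linorder by blast
  qed
  ultimately show ?thesis using that by blast
qed

lemma dp_equivalent_positive_weight:
  assumes k: "k \<in> {1..n}" "lam k > 0"
  shows "\<exists>M0>0. \<forall>M\<ge>M0. dp_equivalent B n x lam p r s M"
proof -
  obtain \<beta>0 R where opt: "is_arg_min H hyp_feasible \<beta>0"
    and R: "\<And>\<beta>. is_arg_min H hyp_feasible \<beta> \<Longrightarrow> normalised B (snd \<beta>) \<Longrightarrow> \<bar>fst \<beta>\<bar> \<le> R"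
    using hyp_optimum_exists[OF k] by blast
  obtain e where e: "e > 0" "cball 0 e \<subseteq> B" by (rule small_ball)
  \<comment> \<open>The first factor bounds the norm of every normalised optimum, the sum bounds
    every \<open>norm (x i)\<close>; Cauchy-Schwarz then bounds all distances.\<close>
  define Q where "Q = (R + 1 / e) * (\<Sum>i=1..n. norm (x i))"
  have Q: "\<bar>inner \<beta> (x i)\<bar> powr p \<le> Q powr p"
    if \<beta>: "is_arg_min H hyp_feasible \<beta>" and v: "normalised B (snd \<beta>)" and i: "i \<in> {1..n}" for \<beta> i
  proof -
    have "norm \<beta> \<le> R + 1 / e"
      using norm_Pair_le[of "fst \<beta>" "snd \<beta>"] R[OF \<beta> v] normalised_norm_le[OF v e(2,1)] by simp
    moreover have "norm (x i) \<le> (\<Sum>i=1..n. norm (x i))" using i by (intro member_le_sum) auto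
    ultimately have "norm \<beta> * norm (x i) \<le> Q"
      unfolding Q_def by (intro mult_mono) (auto intro: order_trans[OF norm_ge_zero])
    then have "\<bar>inner \<beta> (x i)\<bar> \<le> Q" using Cauchy_Schwarz_ineq2 order_trans by blast
    then show ?thesis using p_pos by (intro powr_mono2) auto
  qed
  have "dp_equivalent B n x lam p r s M" if "M \<ge> max 1 (Q powr p)" for M
    using opt by (rule dp_equivalent_bounded) (use Q that in fastforce)
  \<comment> \<open>The maximum with 1 keeps the threshold positive even if Q is 0.\<close>
  then show ?thesis by (intro exI[of _ "max 1 (Q powr p)"]) auto
qed

end

theorem theorem18:
  fixes B :: "(real ^ 'd) set" and n r s :: nat and p :: real
    and x :: "nat \<Rightarrow> real \<times> (real ^ 'd)" and lam :: "nat \<Rightarrow> real"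
  assumes "\<And>i. i \<in> {1..n} \<Longrightarrow> fst (x i) = 1"
    and "\<And>i. i \<in> {1..n} \<Longrightarrow> lam i \<ge> 0"
    and "r > 0" and "s > 0" and "p = real r / real s" and "p \<ge> 1"
    and "polytope B" and "uminus ` B = B" and "interior B \<noteq> {}"
  shows "\<exists>M0>0. \<forall>M\<ge>M0. dp_equivalent B n x lam p r s M"
proof -
  interpret hyperplane_problem B n r s p x lam
    using assms by unfold_locales
  show ?thesis
  proof (cases "\<exists>k\<in>{1..n}. lam k > 0")
    case True
    then show ?thesis using dp_equivalent_positive_weight by blast
  next
    case False
    \<comment> \<open>This case also covers n = 0.\<close>
    then have "lam j = 0" if "j \<in> {1..n}" for j using lam[OF that] that by force
    then show ?thesis using dp_equivalent_zero_weights by (intro exI[of _ 1]) auto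
  qed
qed

end
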